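(* For every $m\geq1$, with $k=\lceil m/2\rceil$, the following polynomials in $x$ are equal: (1) $\det(xI-\mathcal{T}^*_m)$; (2) $\mathcal{M}_m(k)(x-1)$, i.e. the polynomial $\mathcal{M}_m(k)$ in $\Delta$ evaluated at $\Delta=x-1$; (3) $x^k-[1\ x\ \cdots\ x^{k-1}]\,[C^*_m(1)\ \cdots\ C^*_m(k)]^{-1}\,C^*_m(k+1)$.
   Context: Table: for an integer $m\geq1$, define $\mathcal{C}(x,y)=\mathcal{C}_m(x,y)$ for $x\geq1$, $1\leq y\leq m$, as the number of lattice paths (sequences of cells of the $m\times\infty$ table with steps in $\{(1,-1),(1,0),(1,1)\}$, first coordinate being the column) from any cell of the first column to the cell $(x,y)$. Equivalently, $\mathcal{C}(1,y)=1$ and $\mathcal{C}(x+1,y)=\mathcal{C}(x,y-1)+\mathcal{C}(x,y)+\mathcal{C}(x,y+1)$, with $\mathcal{C}(x,0)=\mathcal{C}(x,m+1)=0$. The reduced $n$th column is $C^*_m(n)=[\mathcal{C}(n,1),\ldots,\mathcal{C}(n,\lceil m/2\rceil)]^T$. Reduced matrix: for $k\geq1$ let $\mathcal{O}_k$ and $\mathcal{E}_k$ be the following $k\times k$ tridiagonal matrices. $\mathcal{O}_1=[1]$, $\mathcal{E}_1=[2]$. For $k\geq2$, $\mathcal{O}_k$ has all diagonal, superdiagonal and subdiagonal entries equal to $1$, except that the $(k,k-1)$ entry is $2$; and $\mathcal{E}_k$ has all diagonal, superdiagonal and subdiagonal entries equal to $1$, except that the $(k,k)$ entry is $2$. Put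 $\mathcal{T}^*_m=\mathcal{O}_{\lceil m/2\rceil}$ if $m$ is odd and $\mathcal{T}^*_m=\mathcal{E}_{\lceil m/2\rceil}$ if $m$ is even. Multipliers: $\mathcal{M}_m(n)$, $n\geq0$, are polynomials in $\Delta$ defined by $\mathcal{M}_m(0)=2$ if $m$ is odd and $\mathcal{M}_m(0)=1$ if $m$ is even, $\mathcal{M}_m(1)=\Delta-2+\mathcal{M}_m(0)$, and $\mathcal{M}_m(n+2)=\Delta\mathcal{M}_m(n+1)-\mathcal{M}_m(n)$ for all $n\geq0$. *)

theory Defs
  imports "Jordan_Normal_Form.Char_Poly"
begin

text \<open>Cells are pairs (column, row). A lattice path is the list of the cells it visits.\<close>

definition table :: "nat \<Rightarrow> (int \<times> int) set" where
  "table m = {(a, b). 1 \<le> a \<and> 1 \<le> b \<and> b \<le> int m}"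

definition lattice_step :: "int \<times> int \<Rightarrow> int \<times> int \<Rightarrow> bool" where
  "lattice_step c d \<longleftrightarrow> (fst d - fst c, snd d - snd c) \<in> {(1, -1), (1, 0), (1, 1)}"

definition lattice_paths :: "nat \<Rightarrow> int \<times> int \<Rightarrow> (int \<times> int) list set" where
  "lattice_paths m c = {p. p \<noteq> [] \<and> set p \<subseteq> table m \<and> successively lattice_step p
     \<and> fst (hd p) = 1 \<and> last p = c}"

definition path_count :: "nat \<Rightarrow> nat \<Rightarrow> nat \<Rightarrow> nat" where
  "path_count m x y = card (lattice_paths m (int x, int y))"

definition half :: "nat \<Rightarrow> nat" where
  "half m = nat \<lceil>rat_of_nat m / 2\<rceil>"

text \<open>Vector and matrix indices start at 0, so position \<open>i\<close> holds the entry of row \<open>i + 1\<close> of the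
  table.\<close>

definition reduced_column :: "nat \<Rightarrow> nat \<Rightarrow> rat vec" where
  "reduced_column m n = vec (half m) (\<lambda>i. rat_of_nat (path_count m n (i + 1)))"

definition reduced_columns_mat :: "nat \<Rightarrow> rat mat" where
  "reduced_columns_mat m = mat_of_cols (half m) (map (reduced_column m) [1..<half m + 1])"

text \<open>The special entries of the next two matrices are, counting from 1, at \<open>(k, k - 1)\<close> (absent for
  \<open>k = 1\<close>) and at \<open>(k, k)\<close>.\<close>

definition odd_mat :: "nat \<Rightarrow> rat mat" where
  "odd_mat k = mat k k (\<lambda>(i, j).
     if i + 1 = k \<and> j + 2 = k then 2
     else if i = j \<or> i = j + 1 \<or> j = i + 1 then 1 else 0)"

definition even_mat :: "nat \<Rightarrow> rat mat" where
  "even_mat k = mat k k (\<lambda>(i, j).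
     if i + 1 = k \<and> j + 1 = k then 2
     else if i = j \<or> i = j + 1 \<or> j = i + 1 then 1 else 0)"

definition reduced_mat :: "nat \<Rightarrow> rat mat" where
  "reduced_mat m = (if odd m then odd_mat (half m) else even_mat (half m))"

text \<open>The variable of this polynomial is \<open>\<Delta>\<close>.\<close>

fun multiplier :: "nat \<Rightarrow> nat \<Rightarrow> rat poly" where
  "multiplier m 0 = (if odd m then 2 else 1)"
| "multiplier m (Suc 0) = [:0, 1:] - 2 + multiplier m 0"
| "multiplier m (Suc (Suc n)) = [:0, 1:] * multiplier m (Suc n) - multiplier m n"

end

theory Submission
  imports Defs
begin

text \<open>
  Write \<open>k = half m\<close>, let \<open>E\<close> be the shift of sequences and let \<open>q\<^sub>n\<close> be the \<open>n\<close>th multiplier at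
  \<open>\<Delta> = x - 1\<close>.

  The characteristic polynomial of a tridiagonal matrix satisfies a three-term recurrence in the size
  of the matrix (\<open>char_poly_tridiagonal_step\<close>). As the exceptional entry lies in the last row, deleting
  leading rows and columns stays in the same family, and the recurrence is that of the multipliers;
  this gives \<open>char_poly_reduced_mat\<close>.

  For the third expression, regard each row \<open>y\<close> of the table as a sequence \<open>f\<^sub>y\<close>. The path recurrence
  says \<open>(E - 1) f\<^sub>y = f\<^bsub>y-1\<^esub> + f\<^bsub>y+1\<^esub>\<close>, and reflecting the table exchanges the rows \<open>y\<close> and
  \<open>m + 1 - y\<close>. Starting at the middle row, \<open>q\<^sub>n(E)\<close> therefore moves \<open>f\<^sub>k\<close> outwards to a nonzero
  multiple of \<open>f\<^bsub>k-n\<^esub>\<close> (\<open>shifted_multiplier_middle_row\<close>). As \<open>f\<^sub>0 = 0\<close>, the polynomial \<open>q\<^sub>k\<close>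
  annihilates \<open>f\<^sub>k\<close>, and hence every row (\<open>shifted_multiplier_annihilates\<close>). So the reduced
  columns \<open>1, \<dots>, k + 1\<close> satisfy a linear relation whose coefficients are those of \<open>q\<^sub>k\<close>. Solving it for
  the last column recovers \<open>q\<^sub>k\<close>, provided that the first \<open>k\<close> columns are independent.

  For that independence (\<open>det_reduced_columns_mat\<close>), a vanishing combination of the rows of the
  matrix is a combination \<open>\<Sum> w\<^sub>y f\<^sub>y\<close> whose first \<open>k\<close> terms vanish; being annihilated by the monic
  \<open>q\<^sub>k\<close>, it is zero. The sequences \<open>3 f\<^sub>y - E f\<^sub>y\<close> count the paths that start at one of the two corners of
  the first column, so they form a triangular array with positive diagonal, and all \<open>w\<^sub>y\<close> are \<open>0\<close>
  (\<open>row_seq_independent\<close>).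
\<close>

section \<open>Recurrence and symmetry of the path counts\<close>

lemma half_eq: "half m = (m + 1) div 2"
proof (cases "even m")
  case True
  then obtain k where "m = 2 * k" by (elim evenE)
  then show ?thesis by (simp add: half_def)
next
  case False
  then obtain k where k: "m = 2 * k + 1" by (elim oddE)
  have "\<lceil>rat_of_nat m / 2\<rceil> = int k + 1"
    by (rule ceiling_unique) (auto simp: k field_simps)
  then show ?thesis by (simp add: half_def k nat_add_distrib)
qed

lemma lattice_step_iff:
  "lattice_step (a, b) (int x + 1, int y) \<longleftrightarrow> a = int x \<and> b \<in> {int y - 1, int y, int y + 1}"
  by (auto simp: lattice_step_def)

lemma lattice_paths_outside: "c \<notin> table m \<Longrightarrow> lattice_paths m c = {}"
  using last_in_set by (fastforce simp: lattice_paths_def)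

text \<open>A path of more than one cell arises from a path to one of the at most three possible predecessors of
  its last cell. For \<open>x = 0\<close> the union is empty.\<close>

lemma lattice_paths_column_Suc:
  assumes "1 \<le> y" "y \<le> m"
  shows "lattice_paths m (int (Suc x), int y) =
    (if x = 0 then {[(1, int y)]} else {}) \<union>
    (\<Union>b\<in>{int y - 1, int y, int y + 1}. (\<lambda>p. p @ [(int x + 1, int y)]) ` lattice_paths m (int x, b))"
    (is "?L = ?R")
proof (rule Set.set_eqI)
  fix p :: "(int \<times> int) list"
  let ?c = "(int x + 1, int y)"
  have c: "?c \<in> table m" using assms by (auto simp: table_def)
  show "p \<in> ?L \<longleftrightarrow> p \<in> ?R"
  proof (cases "p \<noteq> [] \<and> last p = ?c")
    case False
    then show ?thesis by (auto simp: lattice_paths_def ac_simps)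
  next
    case True
    then obtain p' where p: "p = p' @ [?c]" by (metis append_butlast_last_id)
    show ?thesis
    proof (cases "p' = []")
      case True
      then show ?thesis using c p by (auto simp: lattice_paths_def ac_simps)
    next
      case False
      have "p \<in> ?L \<longleftrightarrow> set p' \<subseteq> table m \<and> successively lattice_step p' \<and>
          lattice_step (last p') ?c \<and> fst (hd p') = 1"
        using False c by (auto simp: lattice_paths_def p successively_append_iff ac_simps)
      also have "\<dots> \<longleftrightarrow> (\<exists>b\<in>{int y - 1, int y, int y + 1}. p' \<in> lattice_paths m (int x, b))"
        using False by (cases "last p'") (auto simp: lattice_paths_def lattice_step_iff)
      also have "\<dots> \<longleftrightarrow> p \<in> ?R"
        using False by (auto simp: p)
      finally show ?thesis .
    qed
  qed
qed

lemma finite_lattice_paths: "finite (lattice_paths m (int x, b))"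
proof (induction x arbitrary: b)
  case 0
  then show ?case by (simp add: lattice_paths_outside table_def)
next
  case (Suc x)
  show ?case
  proof (cases "1 \<le> b \<and> b \<le> int m")
    case True
    then obtain y where y: "b = int y" by (metis nat_0_le order_trans zero_le_one)
    with True have "1 \<le> y" "y \<le> m" by auto
    then show ?thesis unfolding y lattice_paths_column_Suc[OF \<open>1 \<le> y\<close> \<open>y \<le> m\<close>]
      using Suc.IH by auto
  next
    case False
    then have "(int (Suc x), b) \<notin> table m" by (auto simp: table_def)
    then show ?thesis by (metis lattice_paths_outside finite.emptyI)
  qed
qed

lemma path_count_outside: "y = 0 \<or> y = m + 1 \<Longrightarrow> path_count m x y = 0"
  by (auto simp: path_count_def lattice_paths_outside table_def)

lemma path_count_first:
  assumes "1 \<le> y" "y \<le> m"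
  shows "path_count m 1 y = 1"
  using lattice_paths_column_Suc[OF assms, of 0]
  by (simp add: path_count_def lattice_paths_outside table_def)

lemma path_count_Suc:
  assumes "1 \<le> y" "y \<le> m" "1 \<le> x"
  shows "path_count m (x + 1) y =
    path_count m x (y - 1) + path_count m x y + path_count m x (y + 1)"
proof -
  let ?I = "{int y - 1, int y, int y + 1}"
  let ?f = "\<lambda>p :: (int \<times> int) list. p @ [(int x + 1, int y)]"
  have "path_count m (x + 1) y = card (\<Union>b\<in>?I. ?f ` lattice_paths m (int x, b))"
    using lattice_paths_column_Suc[OF assms(1,2), of x] assms(3) by (simp add: path_count_def)
  also have "\<dots> = (\<Sum>b\<in>?I. card (?f ` lattice_paths m (int x, b)))"
    by (rule card_UN_disjoint) (auto simp: finite_lattice_paths, auto simp: lattice_paths_def)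
  also have "\<dots> = (\<Sum>b\<in>?I. card (lattice_paths m (int x, b)))"
    by (intro sum.cong refl card_image) (auto simp: inj_on_def)
  also have "\<dots> = path_count m x (y - 1) + path_count m x y + path_count m x (y + 1)"
    using assms(1) by (simp add: path_count_def of_nat_diff ac_simps)
  finally show ?thesis .
qed

lemma path_count_reflect:
  assumes "y \<le> m + 1"
  shows "path_count m (Suc x) y = path_count m (Suc x) (m + 1 - y)"
  using assms
proof (induction x arbitrary: y)
  case 0
  then show ?case
    using path_count_first[of y m] path_count_first[of "m + 1 - y" m]
    by (cases "y = 0 \<or> y = m + 1") (auto simp: path_count_outside)
next
  case (Suc x)
  show ?case
  proof (cases "y = 0 \<or> y = m + 1")
    case True
    then show ?thesis by (auto simp: path_count_outside)
  next
    case False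
    with Suc.prems have y: "1 \<le> y" "y \<le> m" by auto
    then have y': "1 \<le> m + 1 - y" "m + 1 - y \<le> m" by auto
    have e: "m + 1 - (y - 1) = m + 1 - y + 1" "m + 1 - (y + 1) = m + 1 - y - 1"
      using y by auto
    show ?thesis
      using path_count_Suc[OF y, of "Suc x"] path_count_Suc[OF y', of "Suc x"]
        Suc.IH[of "y - 1"] Suc.IH[of y] Suc.IH[of "y + 1"] y
      unfolding e by simp
  qed
qed

section \<open>Polynomials in the shift operator\<close>

text \<open>The value at \<open>j\<close> of \<open>p(E) s\<close>, where \<open>E\<close> is the shift \<open>s \<mapsto> (\<lambda>i. s (i + 1))\<close>.\<close>

definition shift_action :: "rat poly \<Rightarrow> (nat \<Rightarrow> rat) \<Rightarrow> nat \<Rightarrow> rat" where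
  "shift_action p s j = (\<Sum>i\<le>degree p. coeff p i * s (i + j))"

lemma shift_action_bound:
  "degree p \<le> N \<Longrightarrow> shift_action p s j = (\<Sum>i\<le>N. coeff p i * s (i + j))"
  unfolding shift_action_def by (rule sum.mono_neutral_left) (auto simp: coeff_eq_0)

lemma shift_action_diff:
  "shift_action (p - q) s j = shift_action p s j - shift_action q s j"
proof -
  let ?N = "max (degree p) (degree q)"
  have "degree (p - q) \<le> ?N" by (rule degree_diff_le_max)
  then show ?thesis
    by (simp add: shift_action_bound[of _ ?N] sum_subtractf[symmetric] left_diff_distrib)
qed

lemma shift_action_pCons:
  "shift_action (pCons a p) s j = a * s j + shift_action p s (Suc j)"
proof -
  have "degree (pCons a p) \<le> Suc (degree p)" by (rule degree_pCons_le)
  then have "shift_action (pCons a p) s j =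
      (\<Sum>i\<le>Suc (degree p). coeff (pCons a p) i * s (i + j))"
    by (rule shift_action_bound)
  then show ?thesis
    by (simp add: sum.atMost_Suc_shift shift_action_def del: sum.atMost_Suc)
qed

lemma shift_action_0: "shift_action 0 s j = 0"
  by (simp add: shift_action_def)

lemma shift_action_linear_factor:
  "shift_action ([:-1, 1:] * p) s j = shift_action p s (Suc j) - shift_action p s j"
proof -
  have "[:-1, 1:] * p = pCons 0 p - p" by simp
  then show ?thesis by (simp only: shift_action_diff shift_action_pCons mult_zero_left add_0)
qed

lemma shift_action_commute:
  "shift_action p (shift_action q s) j = shift_action q (shift_action p s) j"
  unfolding shift_action_def sum_distrib_left
  by (subst sum.swap) (simp add: ac_simps)

lemma shift_action_sum:
  "shift_action p (\<lambda>i. \<Sum>y\<in>A. w y * f y i) j = (\<Sum>y\<in>A. w y * shift_action p (f y) j)"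
  unfolding shift_action_def sum_distrib_left
  by (subst sum.swap) (simp add: ac_simps)

section \<open>The rows of the table and the multipliers\<close>

text \<open>Row \<open>y\<close> of the table as a sequence indexed from 0: the term \<open>i\<close> belongs to column \<open>i + 1\<close>. The values
  \<open>y = 0\<close> and \<open>y = m + 1\<close> are allowed and give the zero sequence.\<close>

definition row_seq :: "nat \<Rightarrow> nat \<Rightarrow> nat \<Rightarrow> rat" where
  "row_seq m y i = rat_of_nat (path_count m (i + 1) y)"

lemma row_seq_0: "1 \<le> y \<Longrightarrow> y \<le> m \<Longrightarrow> row_seq m y 0 = 1"
  using path_count_first[of y m] by (simp add: row_seq_def)

lemma row_seq_boundary: "row_seq m 0 i = 0" "row_seq m (Suc m) i = 0"
  by (simp_all add: row_seq_def path_count_outside)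

lemma row_seq_Suc:
  "1 \<le> y \<Longrightarrow> y \<le> m \<Longrightarrow>
    row_seq m y (Suc i) = row_seq m (y - 1) i + row_seq m y i + row_seq m (y + 1) i"
  using path_count_Suc[of y m "i + 1"] by (simp add: row_seq_def)

lemma row_seq_reflect: "y \<le> m + 1 \<Longrightarrow> row_seq m y i = row_seq m (m + 1 - y) i"
  using path_count_reflect[of y m i] by (simp add: row_seq_def)

lemma half_bounds:
  assumes "m \<ge> 1"
  shows "1 \<le> half m" "half m \<le> m" "m \<le> 2 * half m" "2 * half m \<le> m + 1"
  using assms by (auto simp: half_eq)

text \<open>The multiplier evaluated at \<open>\<Delta> = x - 1\<close>, as a polynomial in \<open>x\<close>.\<close>

definition shifted_multiplier :: "nat \<Rightarrow> nat \<Rightarrow> rat poly" where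
  "shifted_multiplier m n = pcompose (multiplier m n) [:-1, 1:]"

lemma shifted_multiplier_simps:
  "shifted_multiplier m 0 = (if odd m then 2 else 1)"
  "shifted_multiplier m (Suc 0) = [:-1, 1:] - 2 + shifted_multiplier m 0"
  "shifted_multiplier m (Suc (Suc n)) =
     [:-1, 1:] * shifted_multiplier m (Suc n) - shifted_multiplier m n"
  by (simp_all add: shifted_multiplier_def pcompose_diff pcompose_add pcompose_mult pcompose_pCons
      numeral_poly)

text \<open>For odd \<open>m\<close> the row \<open>half m\<close> is fixed by the reflection, so its two neighbours coincide; for even
  \<open>m\<close> it equals its mirror image, the row \<open>half m + 1\<close>. The initial values of the multipliers account for
  these two cases.\<close>

lemma shifted_multiplier_middle_row:
  assumes "m \<ge> 1" "n \<le> half m"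
  shows "shift_action (shifted_multiplier m n) (row_seq m (half m)) j =
    (if odd m then 2 else 1) * row_seq m (half m - n) j"
  using assms(2)
proof (induction n arbitrary: j rule: induct_nat_012)
  case 0
  show ?case
    by (simp add: shifted_multiplier_simps shift_action_def numeral_poly)
next
  case 1
  let ?k = "half m"
  have k: "1 \<le> ?k" "?k \<le> m" using half_bounds[OF assms(1)] by auto
  show ?case
  proof (cases "odd m")
    case True
    then have "m + 1 - (?k + 1) = ?k - 1" by (auto simp: half_eq elim!: oddE)
    then have "row_seq m (?k + 1) j = row_seq m (?k - 1) j"
      using row_seq_reflect[of "?k + 1" m j] k by simp
    then show ?thesis
      using True row_seq_Suc[OF k, of j]
      by (simp add: shifted_multiplier_simps shift_action_pCons shift_action_0)
  next
    case False
    then have "m + 1 - (?k + 1) = ?k" by (auto simp: half_eq elim!: evenE)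
    then have "row_seq m (?k + 1) j = row_seq m ?k j"
      using row_seq_reflect[of "?k + 1" m j] k by simp
    moreover have "[:-1, 1:] - 2 + 1 = [:-2, 1 :: rat:]"
      by (simp add: numeral_poly one_pCons)
    ultimately show ?thesis
      using False row_seq_Suc[OF k, of j]
      by (simp add: shifted_multiplier_simps shift_action_pCons shift_action_0)
  qed
next
  case (ge2 n)
  let ?y = "half m - Suc n"
  have y: "1 \<le> ?y" "?y \<le> m" "?y + 1 = half m - n" "?y - 1 = half m - Suc (Suc n)"
    using half_bounds[OF assms(1)] ge2.prems by auto
  have "shift_action (shifted_multiplier m (Suc (Suc n))) (row_seq m (half m)) j =
      (if odd m then 2 else 1) * (row_seq m ?y (Suc j) - row_seq m ?y j - row_seq m (?y + 1) j)"
    using ge2 y(3)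
    by (simp only: shifted_multiplier_simps(3) shift_action_diff shift_action_linear_factor
        right_diff_distrib)
  also have "row_seq m ?y (Suc j) - row_seq m ?y j - row_seq m (?y + 1) j =
      row_seq m (half m - Suc (Suc n)) j"
    using row_seq_Suc[OF y(1,2), of j] y(4) by simp
  finally show ?case .
qed

text \<open>Row \<open>y\<close> is, up to a nonzero factor, a polynomial in the shift applied to row \<open>half m\<close>, so it suffices
  that the middle row is annihilated.\<close>

lemma shifted_multiplier_annihilates:
  assumes "m \<ge> 1" "y \<le> half m"
  shows "shift_action (shifted_multiplier m (half m)) (row_seq m y) j = 0"
proof -
  define k where "k = half m"
  define a :: rat where "a = (if odd m then 2 else 1)"
  let ?q = "shifted_multiplier m"
  have a: "a \<noteq> 0" by (simp add: a_def)
  have mid: "shift_action (?q n) (row_seq m k) = (\<lambda>i. a * row_seq m (k - n) i)" if "n \<le> k" for n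
    using shifted_multiplier_middle_row[OF assms(1)] that
    by (auto simp: fun_eq_iff k_def a_def)
  have scale: "shift_action p (\<lambda>i. a * s i) j = a * shift_action p s j" for p s
    by (simp add: shift_action_def sum_distrib_left ac_simps)
  have "a * shift_action (?q k) (row_seq m y) j =
      shift_action (?q k) (shift_action (?q (k - y)) (row_seq m k)) j"
    using mid[of "k - y"] assms(2) by (simp add: scale k_def)
  also have "\<dots> = shift_action (?q (k - y)) (shift_action (?q k) (row_seq m k)) j"
    by (rule shift_action_commute)
  also have "\<dots> = 0"
    by (simp add: mid row_seq_boundary shift_action_def)
  finally show ?thesis using a by (simp add: k_def)
qed

section \<open>Linear independence of the rows\<close>

text \<open>The term \<open>i\<close> is the number of paths from the two corners of the first column to the cell
  \<open>(i + 1, y)\<close> (paths from the single corner counted twice if \<open>m = 1\<close>). Indeed these sequences obey the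
  recurrence of the rows, and their initial column is \<open>corner_seq_0\<close>: three times the all-ones column
  exceeds the second column by 1 for each of the
  bottom and top edges of the table that the cell touches.\<close>

definition corner_seq :: "nat \<Rightarrow> nat \<Rightarrow> nat \<Rightarrow> rat" where
  "corner_seq m y i = 3 * row_seq m y i - row_seq m y (Suc i)"

lemma corner_seq_0:
  assumes "1 \<le> y" "y \<le> m"
  shows "corner_seq m y 0 = of_bool (y = 1) + of_bool (y = m)"
proof -
  have "row_seq m (y - 1) 0 = 1 - of_bool (y = 1)"
    using assms row_seq_0[of "y - 1" m] by (cases "y = 1") (auto simp: row_seq_boundary)
  moreover have "row_seq m (y + 1) 0 = 1 - of_bool (y = m)"
    using assms row_seq_0[of "y + 1" m] by (cases "y = m") (auto simp: row_seq_boundary)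
  ultimately show ?thesis
    using row_seq_Suc[OF assms, of 0] row_seq_0[OF assms] by (simp add: corner_seq_def)
qed

lemma corner_seq_Suc:
  assumes "1 \<le> y" "y \<le> m"
  shows "corner_seq m y (Suc i) = corner_seq m (y - 1) i + corner_seq m y i + corner_seq m (y + 1) i"
  using row_seq_Suc[OF assms, of i] row_seq_Suc[OF assms, of "Suc i"] by (simp add: corner_seq_def)

lemma corner_seq_nonneg: "y \<le> m + 1 \<Longrightarrow> corner_seq m y i \<ge> 0"
proof (induction i arbitrary: y)
  case 0
  then show ?case
    using corner_seq_0[of y m]
    by (cases "y = 0 \<or> y = m + 1") (auto simp: corner_seq_def row_seq_boundary)
next
  case (Suc i)
  show ?case
  proof (cases "y = 0 \<or> y = m + 1")
    case True
    then show ?thesis by (auto simp: corner_seq_def row_seq_boundary)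
  next
    case False
    with Suc.prems have "1 \<le> y" "y \<le> m" by auto
    then show ?thesis
      using corner_seq_Suc[of y m i] Suc.IH[of "y - 1"] Suc.IH[of y] Suc.IH[of "y + 1"] by simp
  qed
qed

text \<open>A cell that is too far from both corners is not reached.\<close>

lemma corner_seq_eq_0:
  "i + 1 < y \<Longrightarrow> y + i < m \<Longrightarrow> corner_seq m y i = 0"
proof (induction i arbitrary: y)
  case 0
  then show ?case using corner_seq_0[of y m] by simp
next
  case (Suc i)
  then show ?case
    using corner_seq_Suc[of y m i] Suc.IH[of "y - 1"] Suc.IH[of y] Suc.IH[of "y + 1"] by simp
qed

lemma corner_seq_diagonal_pos: "i < m \<Longrightarrow> corner_seq m (Suc i) i > 0"
proof (induction i)
  case 0
  then show ?case using corner_seq_0[of 1 m] by (simp add: of_bool_def)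
next
  case (Suc i)
  then show ?case
    using corner_seq_Suc[of "Suc (Suc i)" m i] corner_seq_nonneg[of "Suc (Suc i)" m i]
      corner_seq_nonneg[of "Suc (Suc (Suc i))" m i] by simp
qed

text \<open>The matrix with entries \<open>corner_seq m (y + 1) i\<close>, for \<open>y, i < half m\<close>, is triangular with positive
  diagonal: in the upper half of the table the opposite corner comes into play too late.\<close>

lemma row_seq_independent:
  assumes "m \<ge> 1"
    and zero: "\<And>i. (\<Sum>y<half m. w y * row_seq m (Suc y) i) = 0"
    and "y < half m"
  shows "w y = 0"
  using \<open>y < half m\<close>
proof (induction y rule: less_induct)
  case (less y)
  note k = half_bounds[OF assms(1)]
  have "(\<Sum>z<half m. w z * corner_seq m (Suc z) y) =
      3 * (\<Sum>z<half m. w z * row_seq m (Suc z) y) - (\<Sum>z<half m. w z * row_seq m (Suc z) (Suc y))"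
    by (simp add: corner_seq_def sum_distrib_left sum_subtractf[symmetric] algebra_simps)
  then have "(\<Sum>z<half m. w z * corner_seq m (Suc z) y) = 0" by (simp add: zero)
  moreover have "(\<Sum>z<half m. w z * corner_seq m (Suc z) y) =
      (\<Sum>z\<in>{y}. w z * corner_seq m (Suc z) y)"
  proof (rule sum.mono_neutral_right)
    show "\<forall>z\<in>{..<half m} - {y}. w z * corner_seq m (Suc z) y = 0"
    proof
      fix z assume z: "z \<in> {..<half m} - {y}"
      show "w z * corner_seq m (Suc z) y = 0"
      proof (cases "z < y")
        case True
        then show ?thesis using less z by auto
      next
        case False
        then have "corner_seq m (Suc z) y = 0"
          using z k by (intro corner_seq_eq_0) auto
        then show ?thesis by simp
      qed
    qed
  qed (use less.prems in auto)
  ultimately have "w y * corner_seq m (Suc y) y = 0" by simp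
  moreover have "corner_seq m (Suc y) y > 0"
    using less.prems k by (intro corner_seq_diagonal_pos) auto
  ultimately show ?case by simp
qed

text \<open>A linear recurrence of order \<open>degree p\<close> determines a sequence from its first \<open>degree p\<close> terms.\<close>

lemma annihilated_eq_0:
  assumes "monic p"
    and ann: "\<And>j. shift_action p s j = 0"
    and init: "\<And>i. i < degree p \<Longrightarrow> s i = 0"
  shows "s i = 0"
proof (induction i rule: less_induct)
  case (less i)
  show ?case
  proof (cases "i < degree p")
    case True
    then show ?thesis by (rule init)
  next
    case False
    define j where "j = i - degree p"
    have "(\<Sum>l\<le>degree p. coeff p l * s (l + j)) = (\<Sum>l\<in>{degree p}. coeff p l * s (l + j))"
      by (rule sum.mono_neutral_right) (use less False in \<open>auto simp: j_def\<close>)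
    then show ?thesis
      using ann[of j] \<open>monic p\<close> False by (simp add: shift_action_def j_def)
  qed
qed

lemma reduced_columns_mat_carrier: "reduced_columns_mat m \<in> carrier_mat (half m) (half m)"
  by (simp add: reduced_columns_mat_def mat_of_cols_def del: upt_Suc)

lemma reduced_columns_mat_index:
  "i < half m \<Longrightarrow> j < half m \<Longrightarrow> reduced_columns_mat m $$ (i, j) = row_seq m (Suc i) j"
  by (simp add: reduced_columns_mat_def mat_of_cols_index reduced_column_def row_seq_def
      nth_append del: upt_Suc)

lemma det_reduced_columns_mat:
  assumes "m \<ge> 1" "monic (shifted_multiplier m (half m))"
    "degree (shifted_multiplier m (half m)) = half m"
  shows "det (reduced_columns_mat m) \<noteq> 0"
proof
  let ?k = "half m" and ?K = "reduced_columns_mat m"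
  have KT: "?K\<^sup>T \<in> carrier_mat ?k ?k" using reduced_columns_mat_carrier by simp
  assume "det ?K = 0"
  then have "det ?K\<^sup>T = 0" using det_transpose[OF reduced_columns_mat_carrier] by simp
  then obtain w where w: "w \<in> carrier_vec ?k" "w \<noteq> 0\<^sub>v ?k" "?K\<^sup>T *\<^sub>v w = 0\<^sub>v ?k"
    using det_0_iff_vec_prod_zero[OF KT] by blast
  let ?s = "\<lambda>i. \<Sum>y<?k. w $ y * row_seq m (Suc y) i"
  have init: "?s i = 0" if "i < ?k" for i
  proof -
    have "(?K\<^sup>T *\<^sub>v w) $ i = (\<Sum>y<?k. row_seq m (Suc y) i * w $ y)"
      using that w(1) reduced_columns_mat_carrier[of m]
      by (simp add: scalar_prod_def reduced_columns_mat_index atLeast0LessThan)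
    then show ?thesis using w(3) that by (simp add: ac_simps)
  qed
  have "?s i = 0" for i
  proof (rule annihilated_eq_0[where s = ?s, OF assms(2)])
    show "shift_action (shifted_multiplier m ?k) ?s j = 0" for j
      by (simp add: shift_action_sum shifted_multiplier_annihilates[OF assms(1)])
  qed (use init assms(3) in simp)
  then have "w $ y = 0" if "y < ?k" for y
    using row_seq_independent[OF assms(1), of "\<lambda>y. w $ y"] that by simp
  then have "w = 0\<^sub>v ?k" using w(1) by (intro eq_vecI) auto
  with w(2) show False by contradiction
qed

section \<open>Characteristic polynomials of tridiagonal matrices\<close>

lemma det_tridiagonal_step:
  fixes A :: "'a :: comm_ring_1 mat"
  assumes A: "A \<in> carrier_mat (Suc (Suc n)) (Suc (Suc n))"
    and row: "\<And>j. 2 \<le> j \<Longrightarrow> j < Suc (Suc n) \<Longrightarrow> A $$ (0, j) = 0"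
    and col: "\<And>i. 2 \<le> i \<Longrightarrow> i < Suc (Suc n) \<Longrightarrow> A $$ (i, 0) = 0"
  shows "det A = A $$ (0, 0) * det (mat (Suc n) (Suc n) (\<lambda>(i, j). A $$ (Suc i, Suc j))) -
    A $$ (0, 1) * A $$ (1, 0) * det (mat n n (\<lambda>(i, j). A $$ (Suc (Suc i), Suc (Suc j))))"
proof -
  let ?B = "mat_delete A 0 1"
  have B: "?B \<in> carrier_mat (Suc n) (Suc n)" using mat_delete_carrier[OF A] by simp
  have "det A = (\<Sum>j<Suc (Suc n). A $$ (0, j) * cofactor A 0 j)"
    by (rule laplace_expansion_row[OF A]) simp
  also have "\<dots> = (\<Sum>j\<in>{0, 1}. A $$ (0, j) * cofactor A 0 j)"
    by (rule sum.mono_neutral_right) (auto simp: row)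
  finally have "det A = A $$ (0, 0) * det (mat_delete A 0 0) - A $$ (0, 1) * det ?B"
    by (simp add: cofactor_def)
  moreover have "det ?B = A $$ (1, 0) * det (mat_delete ?B 0 0)"
  proof -
    have "det ?B = (\<Sum>i<Suc n. ?B $$ (i, 0) * cofactor ?B i 0)"
      by (rule laplace_expansion_column[OF B]) simp
    also have "\<dots> = (\<Sum>i\<in>{0}. ?B $$ (i, 0) * cofactor ?B i 0)"
      by (rule sum.mono_neutral_right) (use A col in \<open>auto simp: mat_delete_def\<close>)
    finally show ?thesis using A by (simp add: cofactor_def mat_delete_def)
  qed
  moreover have "mat_delete A 0 0 = mat (Suc n) (Suc n) (\<lambda>(i, j). A $$ (Suc i, Suc j))"
    using A by (intro eq_matI) (auto simp: mat_delete_def)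
  moreover have "mat_delete ?B 0 0 = mat n n (\<lambda>(i, j). A $$ (Suc (Suc i), Suc (Suc j)))"
    using A by (intro eq_matI) (auto simp: mat_delete_def)
  ultimately show ?thesis by (simp add: mult.assoc)
qed

lemma char_poly_matrix_index:
  "A \<in> carrier_mat n n \<Longrightarrow> i < n \<Longrightarrow> j < n \<Longrightarrow>
    char_poly_matrix A $$ (i, j) = (if i = j then [:- (A $$ (i, j)), 1:] else [:- (A $$ (i, j)):])"
  by (auto simp: char_poly_matrix_def)

text \<open>The matrices \<open>B\<close> and \<open>C\<close> arise from \<open>A\<close> by deleting the first row and column once and twice.\<close>

lemma char_poly_tridiagonal_step:
  assumes A: "A \<in> carrier_mat (Suc (Suc n)) (Suc (Suc n))"
    and row: "\<And>j. 2 \<le> j \<Longrightarrow> j < Suc (Suc n) \<Longrightarrow> A $$ (0, j) = 0"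
    and col: "\<And>i. 2 \<le> i \<Longrightarrow> i < Suc (Suc n) \<Longrightarrow> A $$ (i, 0) = 0"
    and B: "B \<in> carrier_mat (Suc n) (Suc n)"
      "\<And>i j. i < Suc n \<Longrightarrow> j < Suc n \<Longrightarrow> A $$ (Suc i, Suc j) = B $$ (i, j)"
    and C: "C \<in> carrier_mat n n"
      "\<And>i j. i < n \<Longrightarrow> j < n \<Longrightarrow> A $$ (Suc (Suc i), Suc (Suc j)) = C $$ (i, j)"
  shows "char_poly A = [:- (A $$ (0, 0)), 1:] * char_poly B - [:A $$ (0, 1) * A $$ (1, 0):] * char_poly C"
proof -
  let ?P = char_poly_matrix
  have PA: "?P A \<in> carrier_mat (Suc (Suc n)) (Suc (Suc n))" using A by simp
  have PB: "mat (Suc n) (Suc n) (\<lambda>(i, j). ?P A $$ (Suc i, Suc j)) = ?P B"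
    using B(1) carrier_matD[OF char_poly_matrix_closed[OF B(1)]]
    by (intro eq_matI) (auto simp: char_poly_matrix_index[OF A] char_poly_matrix_index[OF B(1)] B(2))
  have PC: "mat n n (\<lambda>(i, j). ?P A $$ (Suc (Suc i), Suc (Suc j))) = ?P C"
    using C(1) carrier_matD[OF char_poly_matrix_closed[OF C(1)]]
    by (intro eq_matI) (auto simp: char_poly_matrix_index[OF A] char_poly_matrix_index[OF C(1)] C(2))
  have "det (?P A) = ?P A $$ (0, 0) * det (?P B) - ?P A $$ (0, 1) * ?P A $$ (1, 0) * det (?P C)"
    unfolding PB[symmetric] PC[symmetric]
    by (rule det_tridiagonal_step[OF PA]) (auto simp: char_poly_matrix_index[OF A] row col)
  then show ?thesis by (simp add: char_poly_def char_poly_matrix_index[OF A] mult.commute)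
qed

lemma odd_mat_carrier: "odd_mat k \<in> carrier_mat k k"
  by (simp add: odd_mat_def)

lemma even_mat_carrier: "even_mat k \<in> carrier_mat k k"
  by (simp add: even_mat_def)

lemma odd_mat_index:
  "i < k \<Longrightarrow> j < k \<Longrightarrow> odd_mat k $$ (i, j) =
    (if i + 1 = k \<and> j + 2 = k then 2 else if i = j \<or> i = j + 1 \<or> j = i + 1 then 1 else 0)"
  by (simp add: odd_mat_def)

lemma even_mat_index:
  "i < k \<Longrightarrow> j < k \<Longrightarrow> even_mat k $$ (i, j) =
    (if i + 1 = k \<and> j + 1 = k then 2 else if i = j \<or> i = j + 1 \<or> j = i + 1 then 1 else 0)"
  by (simp add: even_mat_def)

lemma char_poly_0: "A \<in> carrier_mat 0 0 \<Longrightarrow> char_poly A = 1"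
  by (simp add: char_poly_def)

lemma char_poly_1: "A \<in> carrier_mat (Suc 0) (Suc 0) \<Longrightarrow> char_poly A = [:- (A $$ (0, 0)), 1:]"
  by (simp add: char_poly_def det_single char_poly_matrix_index)

text \<open>For size 0 the two sides would differ, being 1 and 2. The step to size 2 nevertheless fits the
  recurrence, as the entry 2 of the matrix makes up for the missing factor.\<close>

lemma char_poly_odd_mat:
  assumes "odd m"
  shows "char_poly (odd_mat (Suc n)) = shifted_multiplier m (Suc n)"
proof (induction n rule: induct_nat_012)
  case 0
  show ?case using assms
    by (simp add: char_poly_1[OF odd_mat_carrier] odd_mat_index shifted_multiplier_simps)
next
  case 1
  have "char_poly (odd_mat (Suc (Suc 0))) =
      [:- (odd_mat (Suc (Suc 0)) $$ (0, 0)), 1:] * char_poly (odd_mat (Suc 0)) -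
      [:odd_mat (Suc (Suc 0)) $$ (0, 1) * odd_mat (Suc (Suc 0)) $$ (1, 0):] * char_poly (odd_mat 0)"
    by (rule char_poly_tridiagonal_step[OF odd_mat_carrier _ _ odd_mat_carrier _ odd_mat_carrier])
      (auto simp: odd_mat_index)
  then show ?case using assms
    by (simp add: char_poly_1[OF odd_mat_carrier] char_poly_0[OF odd_mat_carrier]
        odd_mat_index shifted_multiplier_simps numeral_poly)
next
  case (ge2 n)
  let ?A = "odd_mat (Suc (Suc (Suc n)))"
  have "char_poly ?A = [:- (?A $$ (0, 0)), 1:] * char_poly (odd_mat (Suc (Suc n))) -
      [:?A $$ (0, 1) * ?A $$ (1, 0):] * char_poly (odd_mat (Suc n))"
    by (rule char_poly_tridiagonal_step[OF odd_mat_carrier _ _ odd_mat_carrier _ odd_mat_carrier])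
      (auto simp: odd_mat_index)
  also have "\<dots> = shifted_multiplier m (Suc (Suc (Suc n)))"
    unfolding ge2.IH by (simp add: odd_mat_index shifted_multiplier_simps(3))
  finally show ?case .
qed

lemma char_poly_even_mat:
  assumes "even m"
  shows "char_poly (even_mat n) = shifted_multiplier m n"
proof (induction n rule: induct_nat_012)
  case 0
  show ?case using assms
    by (simp add: char_poly_0[OF even_mat_carrier] shifted_multiplier_simps)
next
  case 1
  show ?case using assms
    by (simp add: char_poly_1[OF even_mat_carrier] even_mat_index
        shifted_multiplier_simps numeral_poly one_pCons)
next
  case (ge2 n)
  let ?A = "even_mat (Suc (Suc n))"
  have "char_poly ?A = [:- (?A $$ (0, 0)), 1:] * char_poly (even_mat (Suc n)) -
      [:?A $$ (0, 1) * ?A $$ (1, 0):] * char_poly (even_mat n)"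
    by (rule char_poly_tridiagonal_step[OF even_mat_carrier _ _ even_mat_carrier _ even_mat_carrier])
      (auto simp: even_mat_index)
  also have "\<dots> = shifted_multiplier m (Suc (Suc n))"
    unfolding ge2.IH by (simp add: even_mat_index shifted_multiplier_simps(3))
  finally show ?case .
qed

lemma char_poly_reduced_mat:
  assumes "m \<ge> 1"
  shows "char_poly (reduced_mat m) = shifted_multiplier m (half m)"
proof (cases "odd m")
  case True
  then show ?thesis
    using char_poly_odd_mat[OF True, of "half m - 1"] half_bounds(1)[OF assms]
    by (simp add: reduced_mat_def)
next
  case False
  then show ?thesis by (simp add: reduced_mat_def char_poly_even_mat)
qed

section \<open>The three expressions\<close>

theorem corollary2p9:
  fixes m :: nat
  assumes "m \<ge> 1"
  shows "char_poly (reduced_mat m) = pcompose (multiplier m (half m)) [:-1, 1:] \<and>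
    (\<exists>B \<in> carrier_mat (half m) (half m).
       inverts_mat (reduced_columns_mat m) B \<and> inverts_mat B (reduced_columns_mat m) \<and>
       char_poly (reduced_mat m) =
         monom 1 (half m) -
           vec (half m) (\<lambda>i. monom 1 i) \<bullet>
             map_vec (\<lambda>a. [:a:]) (B *\<^sub>v reduced_column m (half m + 1)))"
proof (intro conjI)
  let ?k = "half m" and ?K = "reduced_columns_mat m"
  define q where "q = shifted_multiplier m ?k"
  have char: "char_poly (reduced_mat m) = q"
    using char_poly_reduced_mat[OF assms] by (simp add: q_def)
  then show "char_poly (reduced_mat m) = pcompose (multiplier m (half m)) [:-1, 1:]"
    by (simp add: q_def shifted_multiplier_def)
  have "reduced_mat m \<in> carrier_mat ?k ?k"
    by (simp add: reduced_mat_def odd_mat_carrier even_mat_carrier)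
  then have q: "degree q = ?k" "coeff q ?k = 1"
    using degree_monic_char_poly char by metis+
  note K = reduced_columns_mat_carrier[of m]
  have "det ?K \<noteq> 0"
    using det_reduced_columns_mat[OF assms] q by (simp add: q_def)
  from det_non_zero_imp_unit[OF K this, unfolded Units_def, of "()"]
  obtain B where B: "B \<in> carrier_mat ?k ?k" and BK: "B * ?K = 1\<^sub>m ?k" and KB: "?K * B = 1\<^sub>m ?k"
    by (auto simp: ring_mat_def)
  \<comment> \<open>The relation with the coefficients of \<open>q\<close> among the reduced columns, solved for the last one\<close>
  define c where "c = vec ?k (\<lambda>i. - coeff q i)"
  have c: "c \<in> carrier_vec ?k" by (simp add: c_def)
  have "reduced_column m (?k + 1) = ?K *\<^sub>v c"
  proof (rule eq_vecI)
    fix y assume "y < dim_vec (?K *\<^sub>v c)"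
    then have y: "y < ?k" using K by simp
    have "0 = shift_action q (row_seq m (Suc y)) 0"
      using shifted_multiplier_annihilates[OF assms, of "Suc y" 0] y by (simp add: q_def)
    also have "\<dots> = row_seq m (Suc y) ?k + (\<Sum>i<?k. coeff q i * row_seq m (Suc y) i)"
      using q by (simp add: shift_action_def lessThan_Suc_atMost[symmetric])
    finally have "row_seq m (Suc y) ?k = (\<Sum>i<?k. row_seq m (Suc y) i * - coeff q i)"
      by (simp add: sum_negf ac_simps add_eq_0_iff)
    then show "reduced_column m (?k + 1) $ y = (?K *\<^sub>v c) $ y"
      using y K
      by (simp add: reduced_column_def scalar_prod_def c_def reduced_columns_mat_index
          row_seq_def atLeast0LessThan)
  qed (use K in \<open>simp add: reduced_column_def\<close>)
  then have "B *\<^sub>v reduced_column m (?k + 1) = (B * ?K) *\<^sub>v c"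
    using assoc_mult_mat_vec[OF B K c] by simp
  then have Bc: "B *\<^sub>v reduced_column m (?k + 1) = c" using BK c by simp
  have "vec ?k (\<lambda>i. monom 1 i) \<bullet> map_vec (\<lambda>a. [:a:]) c = - (\<Sum>i<?k. monom (coeff q i) i)"
    by (simp add: scalar_prod_def c_def atLeast0LessThan smult_monom minus_monom[symmetric] sum_negf)
  moreover have "q = monom 1 ?k + (\<Sum>i<?k. monom (coeff q i) i)"
    using poly_as_sum_of_monoms[of q] q by (simp add: lessThan_Suc_atMost[symmetric])
  ultimately have "q = monom 1 ?k - vec ?k (\<lambda>i. monom 1 i) \<bullet> map_vec (\<lambda>a. [:a:]) c"
    by simp
  then show "\<exists>B \<in> carrier_mat ?k ?k. inverts_mat ?K B \<and> inverts_mat B ?K \<and>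
      char_poly (reduced_mat m) = monom 1 ?k -
        vec ?k (\<lambda>i. monom 1 i) \<bullet> map_vec (\<lambda>a. [:a:]) (B *\<^sub>v reduced_column m (?k + 1))"
    using B BK KB K Bc char by (intro bexI[of _ B]) (auto simp: inverts_mat_def)
qed

end
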